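(* Let $G$ be a finite $2$-group, let $h\ge 2$ be an even integer and $r\ge 1$ an integer, and suppose $D^*(G)\cong X_{h,r}$. Then there exist positive integers $m$ and $d$ such that $h=2^m$ and $r=2^d-1$. Equivalently, every graph in the family $X_{h,r}$ that is realizable as $D^*(G)$ for a finite $2$-group $G$ has the form $X_{2^m,\,2^d-1}$ with $m,d$ positive integers.
   Context: All graphs are finite, simple and undirected. A finite $2$-group is a finite group whose order is a power of $2$; $e$ is the identity and $o(x)$ the order of $x$. For a finite group $G$, the Proper POE Complement Graph $D^*(G)$ has vertex set $G^*=G\setminus\{e\}$, and two distinct vertices $x,y$ are adjacent if and only if $o(xy)$ is not a prime number. For an even integer $h\ge 2$ and an integer $r\ge 1$, the graph $X_{h,r}$ is the join $$X_{h,r}=\overline{K}_{h-1}\vee\left(\bigvee_{i=1}^{r}\left(\tfrac h2\right)K_2\right),$$ where $\overline{K}_{h-1}$ is the edgeless graph on $h-1$ vertices, $\left(\frac h2\right)K_2$ is the disjoint union of $\frac h2$ copies of $K_2$, and the join $\vee$ of pairwise vertex-disjoint graphs is obtained from their disjoint union by adding all edges between vertices of different constituents. *)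

theory Defs
  imports
    "HOL-Computational_Algebra.Primes"
    "HOL-Algebra.Multiplicative_Group"
    "Graph_Theory.Pair_Digraph"
    "Graph_Theory.Digraph_Isomorphism"
begin

text \<open>
  A finite simple undirected graph is a \<open>pair_graph\<close>: a finite digraph whose arcs form a
  symmetric and irreflexive relation, so that each edge \<open>{x, y}\<close> is represented by the two
  arcs \<open>(x, y)\<close> and \<open>(y, x)\<close>.
\<close>

definition edgeless_graph :: "nat \<Rightarrow> nat pair_pre_digraph" where
  "edgeless_graph n = \<lparr> pverts = {..<n}, parcs = {} \<rparr>"

definition complete_graph :: "nat \<Rightarrow> nat pair_pre_digraph" where
  "complete_graph n = \<lparr> pverts = {..<n}, parcs = {(u, v). u < n \<and> v < n \<and> u \<noteq> v} \<rparr>"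

text \<open>The constituents of disjoint unions and joins are made vertex-disjoint by tagging.\<close>

definition copies :: "nat \<Rightarrow> 'a pair_pre_digraph \<Rightarrow> (nat \<times> 'a) pair_pre_digraph" where
  "copies n \<Gamma> =
    \<lparr> pverts = {..<n} \<times> pverts \<Gamma>,
      parcs = {((i, u), (j, v)). i < n \<and> i = j \<and> (u, v) \<in> parcs \<Gamma>} \<rparr>"

definition join :: "'a pair_pre_digraph \<Rightarrow> 'b pair_pre_digraph \<Rightarrow> ('a + 'b) pair_pre_digraph" where
  "join \<Gamma> \<Delta> =
    \<lparr> pverts = pverts \<Gamma> <+> pverts \<Delta>,
      parcs = {(Inl u, Inl v) | u v. (u, v) \<in> parcs \<Gamma>}
            \<union> {(Inr u, Inr v) | u v. (u, v) \<in> parcs \<Delta>}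
            \<union> {(Inl u, Inr v) | u v. u \<in> pverts \<Gamma> \<and> v \<in> pverts \<Delta>}
            \<union> {(Inr v, Inl u) | u v. u \<in> pverts \<Gamma> \<and> v \<in> pverts \<Delta>} \<rparr>"

definition join_family :: "'i set \<Rightarrow> ('i \<Rightarrow> 'a pair_pre_digraph) \<Rightarrow> ('i \<times> 'a) pair_pre_digraph" where
  "join_family I \<Gamma> =
    \<lparr> pverts = (SIGMA i:I. pverts (\<Gamma> i)),
      parcs = {((i, u), (i, v)) | i u v. i \<in> I \<and> (u, v) \<in> parcs (\<Gamma> i)}
            \<union> {((i, u), (j, v)) | i j u v.
                 i \<in> I \<and> j \<in> I \<and> i \<noteq> j \<and> u \<in> pverts (\<Gamma> i) \<and> v \<in> pverts (\<Gamma> j)} \<rparr>"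

text \<open>Intended for even \<open>h \<ge> 2\<close> and \<open>r \<ge> 1\<close>.\<close>

definition X_graph :: "nat \<Rightarrow> nat \<Rightarrow> (nat + nat \<times> nat \<times> nat) pair_pre_digraph" where
  "X_graph h r =
    join (edgeless_graph (h - 1))
         (join_family {1..r} (\<lambda>i. copies (h div 2) (complete_graph 2)))"

text \<open>
  The Proper POE Complement Graph.  The identity has order \<open>1\<close>, which is not prime, so
  \<open>x\<close> and \<open>inv x\<close> are adjacent whenever they are distinct.
\<close>

definition D_star :: "('a, 'b) monoid_scheme \<Rightarrow> 'a pair_pre_digraph" where
  "D_star G =
    \<lparr> pverts = carrier G - {\<one>\<^bsub>G\<^esub>},
      parcs = {(x, y). x \<in> carrier G - {\<one>\<^bsub>G\<^esub>} \<and> y \<in> carrier G - {\<one>\<^bsub>G\<^esub>} \<and> x \<noteq> y \<and>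
                 \<not> prime (group.ord G (x \<otimes>\<^bsub>G\<^esub> y))} \<rparr>"

lemma (in group) ord_mult_comm:
  assumes x: "x \<in> carrier G" and y: "y \<in> carrier G"
  shows "ord (x \<otimes> y) = ord (y \<otimes> x)"
proof -
  have dvd: "ord (b \<otimes> a) dvd ord (a \<otimes> b)" if a: "a \<in> carrier G" and b: "b \<in> carrier G" for a b
  proof -
    have shift: "a \<otimes> (b \<otimes> a) [^] (n::nat) = (a \<otimes> b) [^] n \<otimes> a" for n
    proof (induction n)
      case (Suc n)
      have "a \<otimes> (b \<otimes> a) [^] Suc n = (a \<otimes> (b \<otimes> a) [^] n) \<otimes> (b \<otimes> a)"
        using a b by (simp add: m_assoc)
      also have "\<dots> = (a \<otimes> b) [^] Suc n \<otimes> a"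
        unfolding Suc using a b by (simp add: m_assoc)
      finally show ?case .
    qed (use a in simp)
    have "a \<otimes> (b \<otimes> a) [^] ord (a \<otimes> b) = a"
      using a b by (simp add: shift)
    then have "(b \<otimes> a) [^] ord (a \<otimes> b) = \<one>"
      using a b by (metis l_cancel_one m_closed nat_pow_closed)
    then show ?thesis
      using a b by (simp add: pow_eq_id)
  qed
  show ?thesis
    using dvd[OF x y] dvd[OF y x] by (rule dvd_antisym[rotated])
qed

lemma pair_graph_D_star:
  assumes "group G" and fin: "finite (carrier G)"
  shows "pair_graph (D_star G)"
proof -
  interpret group G by fact
  have "finite (parcs (D_star G))"
    by (rule finite_subset[of _ "carrier G \<times> carrier G"]) (auto simp: D_star_def fin)
  moreover have "sym (parcs (D_star G))"
    by (auto simp: D_star_def sym_def ord_mult_comm)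
  ultimately show ?thesis
    by unfold_locales (auto simp: D_star_def fin symmetric_def)
qed

lemma pair_graph_X_graph: "pair_graph (X_graph h r)"
proof -
  have "parcs (X_graph h r) \<subseteq> pverts (X_graph h r) \<times> pverts (X_graph h r)"
    by (auto simp: X_graph_def join_def join_family_def copies_def complete_graph_def
        edgeless_graph_def)
  moreover have "finite (pverts (X_graph h r))"
    by (auto simp: X_graph_def join_def join_family_def copies_def complete_graph_def
        edgeless_graph_def)
  moreover have "sym (parcs (X_graph h r))"
    by (auto simp: X_graph_def join_def join_family_def copies_def complete_graph_def
        edgeless_graph_def sym_def)
  moreover have "irrefl (parcs (X_graph h r))"
    by (auto simp: X_graph_def join_def join_family_def copies_def complete_graph_def
        edgeless_graph_def irrefl_def)
  ultimately show ?thesis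
    by unfold_locales (auto simp: symmetric_def irrefl_def intro: finite_subset)
qed

end

(* Comparing vertex counts is enough: X_{h,r} has (h - 1) + r h vertices and the other graph has
   |G| - 1, so |G| = h (r + 1), and both factors divide a power of 2. *)
theory Submission
  imports Defs
begin

text \<open>Isomorphic graphs have equally many vertices, so |G| - 1 = (h - 1) + r h, that is, 2^k =
  h (r + 1). Every divisor of a power of the prime 2 is again a power of 2, which applies to both h
  and r + 1.\<close>

lemma digraph_iso_card_verts:
  assumes "digraph_iso G H"
  shows "card (verts G) = card (verts H)"
  using assms
  by (auto simp: digraph_iso_def pre_digraph.digraph_isomorphism_def verts_app_iso card_image)

text \<open>Each of the r joined constituents has \<open>h div 2\<close> copies of an edge; as h may
  be odd here, \<open>h div 2 * 2\<close> is not yet h.\<close>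

lemma card_pverts_X_graph: "card (pverts (X_graph h r)) = h - 1 + r * (h div 2 * 2)"
  by (simp add: X_graph_def join_def join_family_def copies_def complete_graph_def
      edgeless_graph_def card_Plus card_cartesian_product)

lemma (in group) card_pverts_D_star: "card (pverts (D_star G)) = order G - 1"
  by (simp add: D_star_def order_def card_Diff_singleton)

theorem corollary5p2:
  fixes G :: "('a, 'b) monoid_scheme" and h r :: nat
  assumes "group G" and "finite (carrier G)" and "\<exists>k::nat. order G = 2 ^ k"
    and "even h" and "h \<ge> 2" and "r \<ge> 1"
    and "digraph_iso (with_proj (D_star G)) (with_proj (X_graph h r))"
  shows "\<exists>m d :: nat. m > 0 \<and> d > 0 \<and> h = 2 ^ m \<and> r = 2 ^ d - 1"
proof -
  obtain k where k: "order G = 2 ^ k"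
    using assms(3) by blast
  have "order G - 1 = h - 1 + r * h"
    using digraph_iso_card_verts[OF assms(7)] \<open>even h\<close>
    by (simp add: group.card_pverts_D_star[OF \<open>group G\<close>] card_pverts_X_graph)
  \<comment> \<open>Subtraction on naturals truncates: cancelling the - 1 on both sides requires
    \<open>order G\<close> and h to be positive.\<close>
  moreover have "order G > 0"
    using k by simp
  ultimately have prod: "2 ^ k = h * (r + 1)"
    using k \<open>h \<ge> 2\<close> by (simp add: algebra_simps)
  then have "h dvd 2 ^ k" "r + 1 dvd 2 ^ k"
    by (metis dvd_triv_left, metis dvd_triv_right)
  then obtain m d where md: "h = 2 ^ m" "r + 1 = 2 ^ d"
    by (auto simp: divides_primepow_nat)
  \<comment> \<open>A zero exponent would give h = 1 or r + 1 = 1.\<close>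
  have "m > 0" "d > 0"
    using md \<open>h \<ge> 2\<close> \<open>r \<ge> 1\<close> by (auto intro: gr0I)
  moreover have "r = 2 ^ d - 1"
    using md(2) by linarith
  ultimately show ?thesis
    using md(1) by blast
qed

end
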